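(* Let $0<\alpha<1$, $p\in[0,1]$, $T>0$, $h>0$. Let $f=f(x,t)$ be a non-negative function satisfying $$\int_{-\infty}^{\infty}f(x,t)\,dx=\frac{t^{-\alpha}}{\Gamma(1-\alpha)},\qquad t>0,$$ and, for the grid times $t_n=nh$, $n\ge1$, entering the scheme below, $$\|f^n\|_{1,h}=\frac{t_n^{-\alpha}}{\Gamma(1-\alpha)}+\rho(h),$$ where $\rho(h)$ is the quadrature error. Let $u_i^n$ ($i\in\mathbb{Z}$, $n\ge0$) be defined by $u_i^0=\psi(x_i)$ for a numerical initial condition $\psi$ and, for $n\ge1$, $$u_i^n=\sum_{j=0}^{n-1}(b_{n-j}-b_{n-j+1})\left(p\,u_{i+(n-j)}^j+(1-p)\,u_{i-(n-j)}^j\right)+h^{\alpha}\Gamma(2-\alpha)\left(p f_{i-1}^{n+1}+(1-p)f_{i+1}^{n+1}\right),$$ where $b_k=k^{1-\alpha}-(k-1)^{1-\alpha}$. If $\|u^0\|_{1,h}=1$, then for all $n\ge1$ with $t_n=nh\le T$, $$\|u^n\|_{1,h}\le1+T\,\Gamma(2-\alpha)\,h^{\alpha-1}\rho(h).$$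
   Context: Grid: $x_i=ih$, $i\in\mathbb{Z}$, $t_n=nh$, $n\in\mathbb{N}$ (the same step $h$ in space and time); $f_i^n=f(x_i,t_n)$ are the grid values of $f$. Discrete norm: for a grid function $v^n=(v_i^n)_{i\in\mathbb{Z}}$, $\|v^n\|_{1,h}=h\sum_{i\in\mathbb{Z}}|v_i^n|$. *)

theory Defs
  imports "HOL-Analysis.Analysis"
begin

text \<open>Grid functions are functions on the integers. The discrete norm takes values in the
  extended reals, so that it is \<open>\<infinity>\<close> for grid functions that are not summable; an equation or an
  upper bound with a real right-hand side thus includes summability.\<close>

definition grid_norm :: "real \<Rightarrow> (int \<Rightarrow> real) \<Rightarrow> ereal"
  where "grid_norm h v = ereal h * (\<Sum>\<^sub>\<infinity>i. ereal \<bar>v i\<bar>)"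

definition grid_val :: "real \<Rightarrow> (real \<Rightarrow> real \<Rightarrow> real) \<Rightarrow> nat \<Rightarrow> int \<Rightarrow> real"
  where "grid_val h f n i = f (of_int i * h) (of_nat n * h)"

text \<open>Only used for \<open>k \<ge> 1\<close>; for \<open>k = 1\<close> the second term is \<open>0 powr (1 - \<alpha>) = 0\<close>.\<close>

definition b :: "real \<Rightarrow> nat \<Rightarrow> real"
  where "b \<alpha> k = of_nat k powr (1 - \<alpha>) - of_nat (k - 1) powr (1 - \<alpha>)"

end

theory Submission
  imports Defs
begin

text \<open>
  Put \<open>c = h\<^sup>\<alpha> \<Gamma>(2 - \<alpha>) \<rho>(h)\<close>. The weights \<open>b\<^sub>k - b\<^sub>k\<^sub>+\<^sub>1\<close> are non-negative and telescope to
  \<open>1 - b\<^sub>n\<^sub>+\<^sub>1\<close>, and the source term contributes at most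
  \<open>(1 - \<alpha>) (n + 1)\<^sup>-\<^sup>\<alpha> + c \<le> b\<^sub>n\<^sub>+\<^sub>1 + c\<close>, so the norm of \<open>u\<^sup>n\<close> is at most \<open>1 + n c\<close> by induction.
  Replacing \<open>n\<close> by \<open>T / h\<close> requires \<open>\<rho>(h) \<ge> 0\<close>; this holds because \<open>\<rho>(h)\<close> does not depend on the
  time level, the norms of \<open>f\<^sup>n\<close> are non-negative and \<open>t\<^sub>n\<^sup>-\<^sup>\<alpha>\<close> tends to \<open>0\<close>.
\<close>

lemma grid_norm_nonneg: "0 \<le> h \<Longrightarrow> 0 \<le> grid_norm h v"
  unfolding grid_norm_def by (intro ereal_0_le_mult infsum_nonneg) auto

text \<open>A sum of non-negative extended reals is the supremum of its finite partial sums. This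
  moves every later estimate to finite real sums, with no summability to prove, and the direction
  from right to left recovers the norm bound, finiteness included.\<close>

lemma grid_norm_le_iff:
  assumes "0 < h"
  shows "grid_norm h v \<le> ereal B \<longleftrightarrow> (\<forall>F. finite F \<longrightarrow> h * (\<Sum>i\<in>F. \<bar>v i\<bar>) \<le> B)"
proof -
  have "grid_norm h v \<le> ereal B \<longleftrightarrow> (\<Sum>\<^sub>\<infinity>i. ereal \<bar>v i\<bar>) \<le> ereal (B / h)"
    using assms unfolding grid_norm_def
    by (cases "\<Sum>\<^sub>\<infinity>i. ereal \<bar>v i\<bar>") (auto simp: field_simps)
  also have "\<dots> \<longleftrightarrow> (\<forall>F. finite F \<longrightarrow> (\<Sum>i\<in>F. ereal \<bar>v i\<bar>) \<le> ereal (B / h))"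
    by (subst nonneg_infsum_complete) (auto simp: SUP_le_iff)
  also have "\<dots> \<longleftrightarrow> (\<forall>F. finite F \<longrightarrow> h * (\<Sum>i\<in>F. \<bar>v i\<bar>) \<le> B)"
    using assms by (simp add: field_simps)
  finally show ?thesis .
qed

text \<open>A translate of a finite set is again finite, so the bound is uniform in the shift
  \<open>k\<close>. It serves both the neighbours \<open>i - 1\<close>, \<open>i + 1\<close> in the
  source and the memory shifts by \<open>n - j\<close>.\<close>

lemma grid_norm_shift_le:
  assumes "0 < h" "grid_norm h v \<le> ereal B" "finite F"
  shows "h * (\<Sum>i\<in>F. \<bar>v (i + k)\<bar>) \<le> B"
proof -
  have "(\<Sum>i\<in>F. \<bar>v (i + k)\<bar>) = (\<Sum>i\<in>(\<lambda>i. i + k) ` F. \<bar>v i\<bar>)"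
    by (subst sum.reindex) auto
  then show ?thesis
    using assms grid_norm_le_iff[of h v B] by simp
qed

lemma b_1: "b \<alpha> 1 = 1"
  by (simp add: b_def)

text \<open>Mean value theorem for \<open>x powr (1 - \<alpha>)\<close> on [k, k + 1]: its
  derivative decreases, so the values at the endpoints enclose the increment. With
  \<open>1 \<le> k\<close> the interval avoids 0, where the derivative is singular.\<close>

lemma b_Suc_bounds:
  fixes \<alpha> :: real
  assumes "0 < \<alpha>" "\<alpha> < 1" "1 \<le> k"
  shows "(1 - \<alpha>) * of_nat (Suc k) powr (- \<alpha>) \<le> b \<alpha> (Suc k)"
    and "b \<alpha> (Suc k) \<le> (1 - \<alpha>) * of_nat k powr (- \<alpha>)"
proof -
  have "\<exists>z>real k. z < real (Suc k) \<and>
      real (Suc k) powr (1 - \<alpha>) - real k powr (1 - \<alpha>)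
        = (real (Suc k) - real k) * ((1 - \<alpha>) * z powr (- \<alpha>))"
  proof (rule MVT2)
    fix x assume "real k \<le> x" "x \<le> real (Suc k)"
    then show "((\<lambda>x. x powr (1 - \<alpha>)) has_real_derivative (1 - \<alpha>) * x powr (- \<alpha>)) (at x)"
      using assms by (auto intro!: derivative_eq_intros)
  qed simp
  then obtain z where z: "real k < z" "z < real (Suc k)"
      "b \<alpha> (Suc k) = (1 - \<alpha>) * z powr (- \<alpha>)"
    by (auto simp: b_def)
  show "(1 - \<alpha>) * of_nat (Suc k) powr (- \<alpha>) \<le> b \<alpha> (Suc k)"
    unfolding z(3) using z(1,2) assms by (intro mult_left_mono powr_mono2') auto
  show "b \<alpha> (Suc k) \<le> (1 - \<alpha>) * of_nat k powr (- \<alpha>)"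
    unfolding z(3) using z(1,2) assms by (intro mult_left_mono powr_mono2') auto
qed

text \<open>Both increments are compared with the derivative at their common endpoint
  \<open>k\<close>. The lower bound is available only from index 2 on, so \<open>k = 1\<close> uses
  \<open>b \<alpha> 1 = 1\<close> and 1 - \<alpha> \<le> 1 instead.\<close>

lemma b_Suc_le:
  assumes "0 < \<alpha>" "\<alpha> < 1" "1 \<le> k"
  shows "b \<alpha> (Suc k) \<le> b \<alpha> k"
proof (cases "k = 1")
  case True
  then show ?thesis
    using b_Suc_bounds(2)[OF assms(1,2), of 1] assms b_1[of \<alpha>] by simp
next
  case False
  then obtain m where "k = Suc m" "1 \<le> m"
    using assms(3) by (cases k) auto
  then show ?thesis
    using b_Suc_bounds[OF assms(1,2)] assms(3) by (blast intro: order_trans)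
qed

lemma sum_b_diff: "(\<Sum>j<n. b \<alpha> (n - j) - b \<alpha> (n - j + 1)) = 1 - b \<alpha> (n + 1)"
proof -
  have "(\<Sum>j<n. b \<alpha> (n - j) - b \<alpha> (n - j + 1))
      = (\<Sum>j<n. b \<alpha> (Suc n - Suc j) - b \<alpha> (Suc n - j))"
    by (intro sum.cong) (auto simp: Suc_diff_le)
  also have "\<dots> = b \<alpha> (Suc n - n) - b \<alpha> (Suc n - 0)"
    by (rule sum_lessThan_telescope)
  finally show ?thesis
    using b_1[of \<alpha>] by simp
qed

lemma nonneg_if_nonneg_plus_powr:
  fixes \<alpha> h \<rho> G :: real
  assumes "0 < \<alpha>" "0 < h"
    and "\<And>n. 1 \<le> n \<Longrightarrow> 0 \<le> (of_nat (n + 1) * h) powr (- \<alpha>) / G + \<rho>"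
  shows "0 \<le> \<rho>"
proof -
  have "filterlim (\<lambda>n. real (n + 1)) at_top sequentially"
    by (rule filterlim_compose[OF filterlim_real_sequentially filterlim_add_const_nat_at_top])
  then have "filterlim (\<lambda>n. real (n + 1) * h) at_top sequentially"
    using assms(2) by (rule filterlim_at_top_mult_tendsto_pos[OF tendsto_const, rotated])
  then have "(\<lambda>n. (real (n + 1) * h) powr (- \<alpha>)) \<longlonglongrightarrow> 0"
    using assms(1) by (intro tendsto_neg_powr) auto
  then have "(\<lambda>n. (real (n + 1) * h) powr (- \<alpha>) / G + \<rho>) \<longlonglongrightarrow> 0 + \<rho>"
    by (intro tendsto_add tendsto_divide_zero tendsto_const)
  then have "0 \<le> 0 + \<rho>"
    by (rule LIMSEQ_le_const) (use assms(3) in blast)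
  then show ?thesis by simp
qed

theorem theorem4:
  fixes \<alpha> p T h :: real
    and f :: "real \<Rightarrow> real \<Rightarrow> real"
    and \<rho> \<psi> :: "real \<Rightarrow> real"
    and u :: "nat \<Rightarrow> int \<Rightarrow> real"
  assumes "0 < \<alpha>" and "\<alpha> < 1"
    and "0 \<le> p" and "p \<le> 1"
    and "0 < T" and "0 < h"
    and f_nonneg: "\<And>x t. 0 < t \<Longrightarrow> 0 \<le> f x t"
    and f_integral: "\<And>t. 0 < t \<Longrightarrow>
      ((\<lambda>x. f x t) has_integral (t powr (- \<alpha>) / Gamma (1 - \<alpha>))) UNIV"
    and f_norm: "\<And>n. 1 \<le> n \<Longrightarrow>
      grid_norm h (grid_val h f (n + 1)) =
        ereal ((of_nat (n + 1) * h) powr (- \<alpha>) / Gamma (1 - \<alpha>) + \<rho> h)"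
    and u_init: "\<And>i. u 0 i = \<psi> (of_int i * h)"
    and u_step: "\<And>n i. 1 \<le> n \<Longrightarrow>
      u n i =
        (\<Sum>j=0..n-1. (b \<alpha> (n - j) - b \<alpha> (n - j + 1)) *
           (p * u j (i + int (n - j)) + (1 - p) * u j (i - int (n - j))))
        + h powr \<alpha> * Gamma (2 - \<alpha>) *
           (p * grid_val h f (n + 1) (i - 1) + (1 - p) * grid_val h f (n + 1) (i + 1))"
    and u0_norm: "grid_norm h (u 0) = 1"
  shows "\<forall>n\<ge>1. of_nat n * h \<le> T \<longrightarrow>
    grid_norm h (u n) \<le> ereal (1 + T * Gamma (2 - \<alpha>) * h powr (\<alpha> - 1) * \<rho> h)"
proof -
  note params = assms(1-6)
  define c where "c = h powr \<alpha> * Gamma (2 - \<alpha>) * \<rho> h"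
  define w where "w k = b \<alpha> k - b \<alpha> (k + 1)" for k
  define g where "g n i = p * grid_val h f n (i - 1) + (1 - p) * grid_val h f n (i + 1)" for n i
  have w_nonneg: "0 \<le> w k" if "1 \<le> k" for k
    using b_Suc_le[OF assms(1,2) that] by (simp add: w_def)
  have Gamma_pos: "0 < Gamma (1 - \<alpha>)"
    using params by (intro Gamma_real_pos) simp
  have Gamma_eq: "Gamma (2 - \<alpha>) = (1 - \<alpha>) * Gamma (1 - \<alpha>)"
    using Gamma_plus1[of "1 - \<alpha>"] params nonpos_Ints_nonpos[of "1 - \<alpha>"] by force
  have Gamma2_pos: "0 < Gamma (2 - \<alpha>)"
    using Gamma_eq Gamma_pos params by simp
  \<comment> \<open>The norm identity is taken at all levels, also those beyond \<open>T\<close>,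
    since the argument lets \<open>n\<close> tend to infinity.\<close>
  have \<rho>_nonneg: "0 \<le> \<rho> h"
  proof (rule nonneg_if_nonneg_plus_powr[OF params(1,6)])
    fix n :: nat assume "1 \<le> n"
    then show "0 \<le> (of_nat (n + 1) * h) powr (- \<alpha>) / Gamma (1 - \<alpha>) + \<rho> h"
      using grid_norm_nonneg[of h "grid_val h f (n + 1)"] f_norm[of n] params(6) by simp
  qed
  then have c_nonneg: "0 \<le> c"
    using Gamma2_pos by (simp add: c_def)

  have source: "h * (\<Sum>i\<in>F. \<bar>h powr \<alpha> * Gamma (2 - \<alpha>) * g (n + 1) i\<bar>) \<le> b \<alpha> (n + 1) + c"
    if "1 \<le> n" "finite F" for n F
  proof -
    define B where "B = (of_nat (n + 1) * h) powr (- \<alpha>) / Gamma (1 - \<alpha>) + \<rho> h"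
    let ?v = "grid_val h f (n + 1)"
    have shift: "h * (\<Sum>i\<in>F. \<bar>?v (i + k)\<bar>) \<le> B" for k
      using f_norm[OF that(1)] params that(2) by (intro grid_norm_shift_le) (auto simp: B_def)
    have "h * (\<Sum>i\<in>F. \<bar>g (n + 1) i\<bar>) \<le> h * (\<Sum>i\<in>F. p * \<bar>?v (i + (-1))\<bar> + (1 - p) * \<bar>?v (i + 1)\<bar>)"
      using params unfolding g_def
      by (intro mult_left_mono sum_mono order_trans[OF abs_triangle_ineq]) (auto simp: abs_mult)
    also have "\<dots> = p * (h * (\<Sum>i\<in>F. \<bar>?v (i + (-1))\<bar>)) + (1 - p) * (h * (\<Sum>i\<in>F. \<bar>?v (i + 1)\<bar>))"
      by (simp add: sum.distrib sum_distrib_left distrib_left mult.left_commute)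
    also have "\<dots> \<le> p * B + (1 - p) * B"
      using params by (intro add_mono mult_left_mono shift) auto
    finally have "h * (\<Sum>i\<in>F. \<bar>g (n + 1) i\<bar>) \<le> B"
      by (simp add: algebra_simps)
    then have "h powr \<alpha> * Gamma (2 - \<alpha>) * (h * (\<Sum>i\<in>F. \<bar>g (n + 1) i\<bar>)) \<le> h powr \<alpha> * Gamma (2 - \<alpha>) * B"
      using Gamma2_pos by (intro mult_left_mono) auto
    \<comment> \<open>The powers of \<open>h\<close> cancel and the quotient of Gamma values leaves
      1 - \<alpha>. The result is the derivative at the right endpoint of [n, n + 1], because the
      source is sampled at level \<open>n + 1\<close>; hence it lies below
      \<open>b \<alpha> (n + 1)\<close>.\<close>
    also have "\<dots> = (1 - \<alpha>) * of_nat (n + 1) powr (- \<alpha>) + c"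
      using Gamma_pos params(6) unfolding B_def c_def Gamma_eq
      by (simp add: powr_mult powr_minus distrib_left)
    also have "\<dots> \<le> b \<alpha> (n + 1) + c"
      using b_Suc_bounds(1)[OF assms(1,2) that(1)] by simp
    finally show ?thesis
      using Gamma2_pos by (simp add: abs_mult sum_distrib_left mult_ac)
  qed

  have bound: "grid_norm h (u n) \<le> ereal (1 + of_nat n * c)" for n
  \<comment> \<open>The scheme has memory: level \<open>n\<close> involves all earlier levels, not
    only the last one.\<close>
  proof (induction n rule: less_induct)
    case (less n)
    show ?case
    proof (cases "n = 0")
      case True
      then show ?thesis by (simp add: u0_norm one_ereal_def)
    next
      case False
      then have n: "1 \<le> n" by simp
      \<comment> \<open>Both shifts are written as additions so that
        \<open>grid_norm_shift_le\<close> covers them.\<close>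
      have step: "u n i = (\<Sum>j<n. w (n - j) *
            (p * u j (i + int (n - j)) + (1 - p) * u j (i + (- int (n - j)))))
          + h powr \<alpha> * Gamma (2 - \<alpha>) * g (n + 1) i" for i
      proof -
        have "{0..n - 1} = {..<n}" using n by auto
        then show ?thesis
          unfolding u_step[OF n, of i] w_def g_def by (simp only: diff_conv_add_uminus)
      qed
      have "h * (\<Sum>i\<in>F. \<bar>u n i\<bar>) \<le> 1 + of_nat n * c" if F: "finite F" for F
      proof -
        define s where "s j k = h * (\<Sum>i\<in>F. \<bar>u j (i + k)\<bar>)" for j k
        \<comment> \<open>The bound for level \<open>j\<close> is relaxed to that of level n - 1.
          Being independent of \<open>j\<close>, it factors out of the sum and only the total weight
          remains.\<close>
        have shift: "s j k \<le> 1 + (of_nat n - 1) * c" if "j < n" for j k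
        proof -
          have "s j k \<le> 1 + of_nat j * c"
            unfolding s_def using params less.IH[OF that] F by (intro grid_norm_shift_le) auto
          also have "\<dots> \<le> 1 + (of_nat n - 1) * c"
            using that c_nonneg by (intro add_left_mono mult_right_mono) auto
          finally show ?thesis .
        qed
        have "h * (\<Sum>i\<in>F. \<bar>u n i\<bar>)
            \<le> h * (\<Sum>i\<in>F. (\<Sum>j<n. w (n - j) *
                (p * \<bar>u j (i + int (n - j))\<bar> + (1 - p) * \<bar>u j (i + (- int (n - j)))\<bar>))
              + \<bar>h powr \<alpha> * Gamma (2 - \<alpha>) * g (n + 1) i\<bar>)"
        proof (intro mult_left_mono sum_mono)
          fix i
          have "\<bar>w (n - j) * (p * u j (i + int (n - j)) + (1 - p) * u j (i + (- int (n - j))))\<bar>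
              \<le> w (n - j) * (p * \<bar>u j (i + int (n - j))\<bar> + (1 - p) * \<bar>u j (i + (- int (n - j)))\<bar>)"
            if "j < n" for j
            unfolding abs_mult using that w_nonneg[of "n - j"] assms(3,4)
            by (intro mult_mono order_trans[OF abs_triangle_ineq]) (auto simp: abs_mult)
          then show "\<bar>u n i\<bar> \<le> (\<Sum>j<n. w (n - j) *
                (p * \<bar>u j (i + int (n - j))\<bar> + (1 - p) * \<bar>u j (i + (- int (n - j)))\<bar>))
              + \<bar>h powr \<alpha> * Gamma (2 - \<alpha>) * g (n + 1) i\<bar>"
            unfolding step
            by (intro order_trans[OF abs_triangle_ineq] add_mono order_trans[OF sum_abs] sum_mono) auto
        qed (use params in simp)
        \<comment> \<open>Exchanging the finite sums collects the translates of each earlier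
          level.\<close>
        also have "\<dots> = (\<Sum>j<n. w (n - j) * (p * s j (int (n - j)) + (1 - p) * s j (- int (n - j))))
            + h * (\<Sum>i\<in>F. \<bar>h powr \<alpha> * Gamma (2 - \<alpha>) * g (n + 1) i\<bar>)"
          by (simp add: s_def sum.distrib sum_distrib_left distrib_left mult.left_commute
              sum.swap[of _ F "{..<n}"])
        also have "\<dots> \<le> (\<Sum>j<n. w (n - j) *
              (p * (1 + (of_nat n - 1) * c) + (1 - p) * (1 + (of_nat n - 1) * c)))
            + (b \<alpha> (n + 1) + c)"
          using assms(3,4) source[OF n F] w_nonneg
          by (intro add_mono sum_mono mult_left_mono shift) auto
        also have "\<dots> = (\<Sum>j<n. w (n - j)) * (1 + (of_nat n - 1) * c) + (b \<alpha> (n + 1) + c)"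
          unfolding sum_distrib_right by (simp add: algebra_simps)
        \<comment> \<open>The total weight falls short of 1 by \<open>b \<alpha> (n + 1)\<close>,
          and the source restores exactly this amount; what is left over is a non-positive
          term.\<close>
        also have "\<dots> = 1 + of_nat n * c - b \<alpha> (n + 1) * ((of_nat n - 1) * c)"
          unfolding w_def sum_b_diff by (simp add: algebra_simps)
        also have "\<dots> \<le> 1 + of_nat n * c"
        proof -
          have "0 \<le> (1 - \<alpha>) * of_nat (Suc n) powr (- \<alpha>)"
            using params by simp
          also have "\<dots> \<le> b \<alpha> (n + 1)"
            using b_Suc_bounds(1)[OF assms(1,2) n] by simp
          finally show ?thesis
            using n c_nonneg by simp
        qed
        finally show ?thesis .
      qed
      then show ?thesis
        using params by (subst grid_norm_le_iff) auto
    qed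
  qed

  show ?thesis
  proof (intro allI impI)
    fix n :: nat
    assume "1 \<le> n" and n: "of_nat n * h \<le> T"
    have "of_nat n * c \<le> T / h * c"
      using n params c_nonneg by (intro mult_right_mono) (auto simp: field_simps)
    also have "\<dots> = T * Gamma (2 - \<alpha>) * h powr (\<alpha> - 1) * \<rho> h"
      using params by (simp add: c_def powr_diff)
    finally show "grid_norm h (u n) \<le> ereal (1 + T * Gamma (2 - \<alpha>) * h powr (\<alpha> - 1) * \<rho> h)"
      using bound[of n] by (auto intro: order_trans)
  qed
qed

end
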